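(* Assume that a semigroup (or a monoid) $M$ admits a presentation $(S,R)$ satisfying the following conditions: (i) for all $s,s'$ in $S$, there is at most one relation of the form $sv'=s'v$ in $R$; (ii) there exists $\lambda : M\to\mathbb{N}$ satisfying $\lambda(xy)\ge\lambda(x)+\lambda(y)$ for all $x,y$ in $M$ and $\lambda(s)\ge 1$ for each $s$ in $S$; (iii) the right cube condition holds for each triple in $S^3$. Then any two elements of $M$ that admit a common right-multiple admit a least common right-multiple.
   Context: Semigroups are assumed to contain a unit element $1$, so $M$ is treated as a monoid. A semigroup presentation $(S,R)$ consists of a nonempty set $S$ and a family $R$ of relations; a relation is a pair $\{v,v'\}$ of nonempty words of $S^*$ (the free monoid on $S$), written $v=v'$. The presented monoid is $S^*/{\equiv}$, where $\equiv$ is the least congruence on $S^*$ containing $R$; saying that $M$ admits the presentation $(S,R)$ means that $M$ is this monoid, and $\lambda(s)$ refers to the element of $M$ represented by $s$. In (i), $v,v'$ denote words of $S^*$. The empty word is denoted $\varepsilon$. A signed word is a word in the alphabet $S\cup S^{-1}$, where $S^{-1}$ is a disjoint formal copy of $S$. For $w=s_1\cdots s_p\in S^*$, $w^{-1}$ denotes the signed word $s_p^{-1}\cdots s_1^{-1}$. Right-reversing: a signed word $\mathbf{w}$ right-reverses in one step to $\mathbf{w}'$ if $\mathbf{w}'$ is obtained from $\mathbf{w}$ by replacing some subword $s^{-1}s'$ (with $s,s'\in S$) by $v'v^{-1}$, where $v,v'\in S^*$ and $sv'=s'v$ is a relation of $R$, or by deleting some subword $s^{-1}s$ with $s\in S$.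 The relation $\curvearrowright_R$ is the reflexive-transitive closure of one-step right-reversing. Right cube condition for $(u,u',u'')$, where $u,u',u''\in S^*$: for all $v,v'\in S^*$, if $u^{-1}u''u''^{-1}u'\curvearrowright_R v'v^{-1}$, then $(uv')^{-1}(u'v)\curvearrowright_R\varepsilon$. An element $y$ of $M$ is a right-multiple of $x$ if $y=xy'$ for some $y'$ in $M$. A least common right-multiple of $x$ and $y$ is a common right-multiple $z$ of $x$ and $y$ such that every common right-multiple of $x$ and $y$ is a right-multiple of $z$.
   Formalization: Condition (i) is read as at most one pair (v,v') with sv'=s'v in R, so for s=s' a relation sv'=sv with v different from v' is excluded; if one such unordered relation were allowed, the claim would fail, e.g. for R={sa=sb, cc'=dd', cc1=ae, be=dd1}. *)

theory Defs
  imports "HOL-Algebra.Divisibility"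
begin

section \<open>Semigroup presentations\<close>

text \<open>
  The relations of a presentation are unordered pairs \<open>{v, v'}\<close> of nonempty words; the
  trivial case \<open>v = v'\<close> (a singleton) is allowed.
\<close>

definition presentation :: "'a set \<Rightarrow> 'a list set set \<Rightarrow> bool" where
  "presentation S R \<longleftrightarrow>
     S \<noteq> {} \<and>
     (\<forall>r\<in>R. \<exists>v\<in>lists S. \<exists>v'\<in>lists S. v \<noteq> [] \<and> v' \<noteq> [] \<and> r = {v, v'})"

inductive_set pres_cong :: "'a set \<Rightarrow> 'a list set set \<Rightarrow> ('a list \<times> 'a list) set"
  for S :: "'a set" and R :: "'a list set set" where
  relation: "{v, v'} \<in> R \<Longrightarrow> (v, v') \<in> pres_cong S R"
| refl: "v \<in> lists S \<Longrightarrow> (v, v) \<in> pres_cong S R"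
| sym: "(u, v) \<in> pres_cong S R \<Longrightarrow> (v, u) \<in> pres_cong S R"
| trans: "(u, v) \<in> pres_cong S R \<Longrightarrow> (v, w) \<in> pres_cong S R \<Longrightarrow> (u, w) \<in> pres_cong S R"
| append: "(u, u') \<in> pres_cong S R \<Longrightarrow> (v, v') \<in> pres_cong S R \<Longrightarrow>
    (u @ v, u' @ v') \<in> pres_cong S R"

definition pres_class :: "'a set \<Rightarrow> 'a list set set \<Rightarrow> 'a list \<Rightarrow> 'a list set" where
  "pres_class S R w = pres_cong S R `` {w}"

definition presented_monoid :: "'a set \<Rightarrow> 'a list set set \<Rightarrow> 'a list set monoid" where
  "presented_monoid S R =
     \<lparr>carrier = lists S // pres_cong S R,
      mult = (\<lambda>A B. \<Union>u\<in>A. \<Union>v\<in>B. pres_class S R (u @ v)),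
      one = pres_class S R []\<rparr>"

lemma pres_cong_in_lists:
  assumes "presentation S R" "(u, v) \<in> pres_cong S R"
  shows "u \<in> lists S \<and> v \<in> lists S"
  using assms(2)
proof induction
  case (relation v v')
  then obtain a b where ab: "a \<in> lists S" "b \<in> lists S" "{v, v'} = {a, b}"
    using assms(1) unfolding presentation_def by meson
  from ab(3) have "v = a \<and> v' = b \<or> v = b \<and> v' = a"
    by (simp only: doubleton_eq_iff)
  then show ?case using ab(1,2) by metis
next
  case (append u u' v v')
  then show ?case by (simp only: append_in_lists_conv simp_thms)
qed simp_all

lemma equiv_pres_cong:
  assumes "presentation S R"
  shows "equiv (lists S) (pres_cong S R)"
proof (rule equivI)
  show "pres_cong S R \<subseteq> lists S \<times> lists S"
    using pres_cong_in_lists[OF assms] by auto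
  show "refl_on (lists S) (pres_cong S R)"
    by (auto simp: refl_on_def intro: pres_cong.refl)
  show "sym (pres_cong S R)"
    by (rule symI) (rule pres_cong.sym)
  show "trans (pres_cong S R)"
    by (rule transI) (rule pres_cong.trans)
qed

lemma pres_class_mult:
  assumes "presentation S R" "u \<in> lists S" "v \<in> lists S"
  shows "pres_class S R u \<otimes>\<^bsub>presented_monoid S R\<^esub> pres_class S R v = pres_class S R (u @ v)"
proof -
  have eq: "pres_class S R (u' @ v') = pres_class S R (u @ v)"
    if "u' \<in> pres_class S R u" "v' \<in> pres_class S R v" for u' v'
  proof -
    have "(u, u') \<in> pres_cong S R" "(v, v') \<in> pres_cong S R"
      using that by (simp_all add: pres_class_def)
    then have "(u' @ v', u @ v) \<in> pres_cong S R"
      by (rule pres_cong.sym[OF pres_cong.append])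
    then show ?thesis
      unfolding pres_class_def by (rule equiv_class_eq[OF equiv_pres_cong[OF assms(1)]])
  qed
  have u: "u \<in> pres_class S R u" and v: "v \<in> pres_class S R v"
    using assms by (simp_all add: pres_class_def pres_cong.refl)
  have "(\<Union>v'\<in>pres_class S R v. pres_class S R (u' @ v')) = pres_class S R (u @ v)"
    if "u' \<in> pres_class S R u" for u'
    by (rule UN_constant_eq[OF v]) (rule ballI, rule eq[OF that])
  then have "(\<Union>u'\<in>pres_class S R u. \<Union>v'\<in>pres_class S R v. pres_class S R (u' @ v'))
      = pres_class S R (u @ v)"
    by (intro UN_constant_eq[OF u] ballI)
  then show ?thesis
    by (simp add: presented_monoid_def)
qed

lemma monoid_presented_monoid:
  assumes "presentation S R"
  shows "monoid (presented_monoid S R)"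
proof -
  have carr: "\<exists>u\<in>lists S. x = pres_class S R u" if "x \<in> carrier (presented_monoid S R)" for x
    using that by (simp add: presented_monoid_def pres_class_def quotient_def)
  have cl: "pres_class S R u \<in> carrier (presented_monoid S R)" if "u \<in> lists S" for u
    using that by (simp add: presented_monoid_def pres_class_def quotientI del: in_lists_conv_set)
  have one: "\<one>\<^bsub>presented_monoid S R\<^esub> = pres_class S R []"
    by (simp add: presented_monoid_def)
  have nil: "[] \<in> lists S" by simp
  have app: "u @ v \<in> lists S" if "u \<in> lists S" "v \<in> lists S" for u v
    using that by simp
  note mult = pres_class_mult[OF assms]
  show ?thesis
  proof (rule monoidI)
    fix x y assume "x \<in> carrier (presented_monoid S R)" "y \<in> carrier (presented_monoid S R)"
    then obtain u v where "u \<in> lists S" "v \<in> lists S"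
      "x = pres_class S R u" "y = pres_class S R v"
      using carr by meson
    then show "x \<otimes>\<^bsub>presented_monoid S R\<^esub> y \<in> carrier (presented_monoid S R)"
      by (simp only: mult cl app)
  next
    show "\<one>\<^bsub>presented_monoid S R\<^esub> \<in> carrier (presented_monoid S R)"
      by (simp only: one cl nil)
  next
    fix x y z assume "x \<in> carrier (presented_monoid S R)" "y \<in> carrier (presented_monoid S R)"
      "z \<in> carrier (presented_monoid S R)"
    then obtain u v w where "u \<in> lists S" "v \<in> lists S" "w \<in> lists S"
      "x = pres_class S R u" "y = pres_class S R v" "z = pres_class S R w"
      using carr by meson
    then show "x \<otimes>\<^bsub>presented_monoid S R\<^esub> y \<otimes>\<^bsub>presented_monoid S R\<^esub> z =
      x \<otimes>\<^bsub>presented_monoid S R\<^esub> (y \<otimes>\<^bsub>presented_monoid S R\<^esub> z)"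
      by (simp only: mult app append_assoc)
  next
    fix x assume "x \<in> carrier (presented_monoid S R)"
    then obtain u where "u \<in> lists S" "x = pres_class S R u" using carr by meson
    then show "\<one>\<^bsub>presented_monoid S R\<^esub> \<otimes>\<^bsub>presented_monoid S R\<^esub> x = x"
      "x \<otimes>\<^bsub>presented_monoid S R\<^esub> \<one>\<^bsub>presented_monoid S R\<^esub> = x"
      by (simp_all only: one mult nil append_Nil append_Nil2)
  qed
qed

text \<open>
  \<open>M\<close> admits the presentation \<open>(S, R)\<close> when it is, up to an isomorphism \<open>\<phi>\<close>, the presented
  monoid; the element of \<open>M\<close> represented by a word \<open>w\<close> is then \<open>\<phi> (pres_class S R w)\<close>.
\<close>

definition admits_presentation ::
  "('m, 'b) monoid_scheme \<Rightarrow> 'a set \<Rightarrow> 'a list set set \<Rightarrow> ('a list set \<Rightarrow> 'm) \<Rightarrow> bool" where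
  "admits_presentation M S R \<phi> \<longleftrightarrow>
     monoid M \<and> presentation S R \<and> \<phi> \<in> iso (presented_monoid S R) M"


section \<open>Right-reversing\<close>

datatype 'a signed = Pos 'a | Neg 'a

definition pos_word :: "'a list \<Rightarrow> 'a signed list" where
  "pos_word w = map Pos w"

definition inv_word :: "'a list \<Rightarrow> 'a signed list" where
  "inv_word w = rev (map Neg w)"

inductive right_rev_step :: "'a set \<Rightarrow> 'a list set set \<Rightarrow> 'a signed list \<Rightarrow> 'a signed list \<Rightarrow> bool"
  for S :: "'a set" and R :: "'a list set set" where
  replace: "\<lbrakk>s \<in> S; s' \<in> S; v \<in> lists S; v' \<in> lists S; {s # v', s' # v} \<in> R\<rbrakk> \<Longrightarrow>
    right_rev_step S R (x @ [Neg s, Pos s'] @ y) (x @ pos_word v' @ inv_word v @ y)"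
| delete: "s \<in> S \<Longrightarrow> right_rev_step S R (x @ [Neg s, Pos s] @ y) (x @ y)"

definition right_reverses ::
  "'a set \<Rightarrow> 'a list set set \<Rightarrow> 'a signed list \<Rightarrow> 'a signed list \<Rightarrow> bool" where
  "right_reverses S R = (right_rev_step S R)\<^sup>*\<^sup>*"

definition right_cube_condition ::
  "'a set \<Rightarrow> 'a list set set \<Rightarrow> 'a list \<Rightarrow> 'a list \<Rightarrow> 'a list \<Rightarrow> bool" where
  "right_cube_condition S R u u' u'' \<longleftrightarrow>
     (\<forall>v\<in>lists S. \<forall>v'\<in>lists S.
        right_reverses S R (inv_word u @ pos_word u'' @ inv_word u'' @ pos_word u')
          (pos_word v' @ inv_word v) \<longrightarrow>
        right_reverses S R (inv_word (u @ v') @ pos_word (u' @ v)) [])"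

text \<open>
  At most one pair \<open>(v', v)\<close> of words for each pair of letters \<open>(s, s')\<close>.  Relations being
  unordered, for \<open>s' = s\<close> a relation \<open>s v' = s v\<close> yields both \<open>(v', v)\<close> and \<open>(v, v')\<close>, so
  that it is admitted only if it is trivial.
\<close>

definition at_most_one_relation :: "'a set \<Rightarrow> 'a list set set \<Rightarrow> 'a \<Rightarrow> 'a \<Rightarrow> bool" where
  "at_most_one_relation S R s s' \<longleftrightarrow>
     (\<forall>v\<^sub>1\<in>lists S. \<forall>v\<^sub>1'\<in>lists S. \<forall>v\<^sub>2\<in>lists S. \<forall>v\<^sub>2'\<in>lists S.
        {s # v\<^sub>1', s' # v\<^sub>1} \<in> R \<and> {s # v\<^sub>2', s' # v\<^sub>2} \<in> R \<longrightarrow> v\<^sub>1 = v\<^sub>2 \<and> v\<^sub>1' = v\<^sub>2')"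

text \<open>
  No definition is needed for right-multiples: \<open>y\<close> is a right-multiple of \<open>x\<close> iff
  \<open>x divides\<^bsub>M\<^esub> y\<close>, and a least common right-multiple of \<open>x\<close> and \<open>y\<close> is a \<open>z\<close> with
  \<open>z lcmof\<^bsub>M\<^esub> x y\<close>.  Neither \<open>factor\<close> nor \<open>islcm\<close> presupposes commutativity.
\<close>

end

theory Submission
  imports Defs
begin

text \<open>
  Garside's induction.  Say that a relation between the first letters of two equivalent words
  \<open>s u\<close> and \<open>s' u'\<close> \<^emph>\<open>factors\<close> them if it is \<open>s g = s' h\<close> with \<open>u \<equiv> g t\<close> and \<open>u' \<equiv> h t\<close>
  (or \<open>s = s'\<close> and \<open>u \<equiv> u'\<close>).  By induction on \<open>\<lambda>\<close>, any two equivalent words are factored: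
  the only difficult case is transitivity through \<open>s'' u''\<close>, where the two factorizations of
  \<open>u''\<close> have a common right-multiple that is smaller for \<open>\<lambda>\<close>; a grid of reversings then
  yields a reversing of \<open>s\<^sup>-\<^sup>1 s'' s''\<^sup>-\<^sup>1 s'\<close>, to which the cube condition applies.  Once all
  equivalent words are factored, the same grid, whose result does not depend on the common
  multiple because of (i), computes least common right-multiples.
\<close>

section \<open>Signed words and reversing in context\<close>

lemma right_reverses_context:
  assumes "right_reverses S R w w'"
  shows "right_reverses S R (x @ w @ y) (x @ w' @ y)"
proof -
  have step: "right_rev_step S R (x @ a @ y) (x @ b @ y)" if "right_rev_step S R a b" for a b
    using that
  proof cases
    case (replace s s' v v' p q)
    then show ?thesis
      using right_rev_step.replace[of s S s' v v' R "x @ p" "q @ y"] by simp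
  next
    case (delete s p q)
    then show ?thesis
      using right_rev_step.delete[of s S R "x @ p" "q @ y"] by simp
  qed
  from assms show ?thesis
    unfolding right_reverses_def
    by induction (auto intro: step rtranclp.rtrancl_into_rtrancl)
qed

lemma right_reverses_trans:
  "right_reverses S R u v \<Longrightarrow> right_reverses S R v w \<Longrightarrow> right_reverses S R u w"
  unfolding right_reverses_def by (rule rtranclp_trans)

lemma word_simps [simp]:
  "pos_word [] = []" "inv_word [] = []"
  "pos_word (u @ v) = pos_word u @ pos_word v"
  "inv_word (u @ v) = inv_word v @ inv_word u"
  "pos_word (s # u) = Pos s # pos_word u"
  "inv_word (s # u) = inv_word u @ [Neg s]"
  by (simp_all add: pos_word_def inv_word_def)

text \<open>A negative word followed by a positive one changes sign only once, so the displayed pair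
  has to straddle the border between the two.\<close>

lemma neg_pos_split:
  assumes "x @ Neg a # Pos b # y = map Neg l @ map Pos r"
  shows "\<exists>l' r'. l = l' @ [a] \<and> r = b # r' \<and> x = map Neg l' \<and> y = map Pos r'"
  using assms
proof (induction x arbitrary: l)
  case Nil
  then show ?case
    by (cases l; cases "tl l"; cases r) auto
next
  case (Cons c x)
  show ?case
  proof (cases l)
    case Nil
    then have "Neg a \<in> set (map Pos r)"
      using Cons.prems by (metis in_set_conv_decomp append_Nil list.map(1) append_Cons)
    then show ?thesis by auto
  next
    case (Cons d l1)
    with Cons.prems have "x @ Neg a # Pos b # y = map Neg l1 @ map Pos r" "c = Neg d"
      by simp_all
    with Cons.IH obtain l' r' where "l1 = l' @ [a]" "r = b # r'" "x = map Neg l'" "y = map Pos r'"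
      by blast
    then show ?thesis
      using Cons \<open>c = Neg d\<close> by (intro exI[of _ "d # l'"] exI[of _ r']) simp
  qed
qed

lemma neg_pos_word_split:
  assumes "x @ Neg a # Pos b # y = inv_word (s # u) @ pos_word (s' # u')"
  shows "a = s \<and> b = s' \<and> x = inv_word u \<and> y = pos_word u'"
proof -
  have "x @ Neg a # Pos b # y = map Neg (rev (s # u)) @ map Pos (s' # u')"
    using assms by (simp add: inv_word_def pos_word_def rev_map)
  from neg_pos_split[OF this] show ?thesis
    by (auto simp: inv_word_def pos_word_def rev_map)
qed

section \<open>Graded words up to equivalence\<close>

locale graded_presentation =
  fixes S :: "'a set" and R :: "'a list set set" and len :: "'a list \<Rightarrow> nat"
  assumes presentation: "presentation S R"
    and at_most_one: "s \<in> S \<Longrightarrow> s' \<in> S \<Longrightarrow> at_most_one_relation S R s s'"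
    and len_append: "u \<in> lists S \<Longrightarrow> v \<in> lists S \<Longrightarrow> len u + len v \<le> len (u @ v)"
    and len_letter: "s \<in> S \<Longrightarrow> 1 \<le> len [s]"
    and len_cong: "(u, v) \<in> pres_cong S R \<Longrightarrow> len u = len v"
begin

abbreviation cong (infix "\<approx>" 50) where
  "u \<approx> v \<equiv> (u, v) \<in> pres_cong S R"

lemmas cong_sym = pres_cong.sym[where S = S and R = R]
lemmas cong_trans [trans] = pres_cong.trans[where S = S and R = R]
lemmas cong_append = pres_cong.append[where S = S and R = R]

lemma cong_lists: "u \<approx> v \<Longrightarrow> u \<in> lists S \<and> v \<in> lists S"
  using pres_cong_in_lists[OF presentation] .

lemma cong_refl: "u \<in> lists S \<Longrightarrow> u \<approx> u"
  by (rule pres_cong.refl)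

lemma cong_left: "u \<approx> v \<Longrightarrow> w \<in> lists S \<Longrightarrow> w @ u \<approx> w @ v"
  by (rule cong_append[OF cong_refl])

lemma cong_right: "u \<approx> v \<Longrightarrow> w \<in> lists S \<Longrightarrow> u @ w \<approx> v @ w"
  by (rule cong_append[OF _ cong_refl])

lemma cong_Cons: "u \<approx> v \<Longrightarrow> s \<in> S \<Longrightarrow> s # u \<approx> s # v"
  using cong_left[of u v "[s]"] by simp

lemma relation_lists:
  assumes "{v, v'} \<in> R"
  shows "v \<in> lists S" "v' \<in> lists S" "v \<noteq> []" "v' \<noteq> []"
proof -
  obtain a b where "a \<in> lists S" "b \<in> lists S" "a \<noteq> []" "b \<noteq> []" "{v, v'} = {a, b}"
    using presentation assms unfolding presentation_def by meson
  then show "v \<in> lists S" "v' \<in> lists S" "v \<noteq> []" "v' \<noteq> []"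
    unfolding doubleton_eq_iff by (metis, metis, metis, metis)
qed

lemma len_suffix: "u \<in> lists S \<Longrightarrow> v \<in> lists S \<Longrightarrow> len v \<le> len (u @ v)"
  using len_append[of u v] by linarith

lemma len_Cons: "s \<in> S \<Longrightarrow> u \<in> lists S \<Longrightarrow> len u < len (s # u)"
  using len_append[of "[s]" u] len_letter[of s] by simp

section \<open>Soundness of reversing\<close>

text \<open>
  A signed word acts on the words up to equivalence by letting \<open>Pos s\<close> remove a first letter
  \<open>s\<close> and \<open>Neg s\<close> prepend it.  Reversing can only shrink the graph of this action.
\<close>

fun tail_rel :: "'a signed list \<Rightarrow> 'a list \<Rightarrow> 'a list \<Rightarrow> bool" where
  "tail_rel [] x y \<longleftrightarrow> x \<approx> y"
| "tail_rel (Pos s # w) x y \<longleftrightarrow> (\<exists>x'. x \<approx> s # x' \<and> tail_rel w x' y)"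
| "tail_rel (Neg s # w) x y \<longleftrightarrow> tail_rel w (s # x) y"

lemma tail_rel_lists: "tail_rel w x y \<Longrightarrow> x \<in> lists S \<and> y \<in> lists S"
  by (induction w x y rule: tail_rel.induct) (auto dest: cong_lists)

text \<open>Makes \<open>[]\<close>, which acts as \<open>\<approx>\<close>, neutral for
  composition; \<open>tail_rel_append\<close> depends on this.\<close>

lemma tail_rel_cong: "tail_rel w x y \<Longrightarrow> x' \<approx> x \<Longrightarrow> tail_rel w x' y"
proof (induction w x y arbitrary: x' rule: tail_rel.induct)
  case (1 x y)
  then show ?case by (auto intro: cong_trans)
next
  case (2 s w x y)
  then show ?case by (auto intro: cong_trans)
next
  case (3 s w x y)
  then have "s \<in> S" using tail_rel_lists[of w "s # x" y] by simp
  with 3 show ?case by (auto intro: cong_Cons)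
qed

lemma tail_rel_append:
  "tail_rel (w @ w') x y \<longleftrightarrow> (\<exists>z. tail_rel w x z \<and> tail_rel w' z y)"
proof (induction w arbitrary: x)
  case Nil
  show ?case
    using tail_rel_lists tail_rel_cong cong_refl by (auto, blast)
next
  case (Cons a w)
  then show ?case by (cases a) auto
qed

lemma tail_rel_pos_word: "v \<in> lists S \<Longrightarrow> tail_rel (pos_word v) x y \<longleftrightarrow> x \<approx> v @ y"
proof (induction v arbitrary: x)
  case (Cons s v)
  have "(\<exists>x'. x \<approx> s # x' \<and> x' \<approx> v @ y) \<longleftrightarrow> x \<approx> s # v @ y" (is "?L \<longleftrightarrow> ?R")
  proof
    assume ?L
    then show ?R using Cons.prems by (auto intro: cong_trans cong_Cons)
  next
    assume ?R
    then have "v @ y \<approx> v @ y" using cong_lists[OF \<open>?R\<close>] by (intro cong_refl) simp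
    with \<open>?R\<close> show ?L by blast
  qed
  with Cons show ?case by simp
qed simp

lemma tail_rel_inv_word: "tail_rel (inv_word v) x y \<longleftrightarrow> v @ x \<approx> y"
proof (induction v arbitrary: x y)
  case (Cons s v)
  have "tail_rel (inv_word (s # v)) x y \<longleftrightarrow> (\<exists>z. v @ x \<approx> z \<and> s # z \<approx> y)"
    by (simp add: tail_rel_append Cons.IH)
  also have "\<dots> \<longleftrightarrow> s # v @ x \<approx> y"
  proof
    assume "\<exists>z. v @ x \<approx> z \<and> s # z \<approx> y"
    then obtain z where "v @ x \<approx> z" "s # z \<approx> y" by blast
    moreover have "s \<in> S" using cong_lists[OF \<open>s # z \<approx> y\<close>] by simp
    ultimately show "s # v @ x \<approx> y" by (blast intro: cong_Cons cong_trans)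
  next
    assume *: "s # v @ x \<approx> y"
    then have "v @ x \<approx> v @ x" using cong_lists[OF *] by (intro cong_refl) simp
    with * show "\<exists>z. v @ x \<approx> z \<and> s # z \<approx> y" by blast
  qed
  finally show ?case by simp
qed simp

text \<open>A path from \<open>a\<close> through \<open>v'\<close> to \<open>b\<close> and back
  through the inverse of \<open>v\<close> to \<open>c\<close> gives
  \<open>s a \<approx> s v' b \<approx> s' v b \<approx> s' c\<close>, hence a path from
  \<open>a\<close> to \<open>c\<close> through the replaced pair of letters.\<close>

lemma tail_rel_step:
  assumes "right_rev_step S R w w'" "tail_rel w' x y"
  shows "tail_rel w x y"
  using assms(1)
proof cases
  case (replace s s' v v' p q)
  with assms(2) obtain a b c where
    ab: "tail_rel p x a" "a \<approx> v' @ b" and bc: "v @ b \<approx> c" "tail_rel q c y"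
    by (auto simp: tail_rel_append tail_rel_pos_word tail_rel_inv_word simp del: in_lists_conv_set)
  have b: "b \<in> lists S" using cong_lists[OF bc(1)] by simp
  have "s # a \<approx> (s # v') @ b"
    using cong_Cons[OF ab(2)] replace by simp
  also have "(s # v') @ b \<approx> (s' # v) @ b"
    by (rule cong_right[OF pres_cong.relation b]) (use replace in simp)
  also have "(s' # v) @ b \<approx> s' # c"
    using cong_Cons[OF bc(1)] replace by simp
  finally show ?thesis
    using replace ab(1) bc(2) by (auto simp: tail_rel_append)
next
  case (delete s p q)
  with assms(2) obtain a where "tail_rel p x a" "tail_rel q a y"
    by (auto simp: tail_rel_append)
  moreover from this have "s # a \<approx> s # a"
    using delete tail_rel_lists by (intro cong_refl) auto
  ultimately show ?thesis
    using delete by (auto simp: tail_rel_append)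
qed

lemma tail_rel_reverses:
  "right_reverses S R w w' \<Longrightarrow> tail_rel w' x y \<Longrightarrow> tail_rel w x y"
  unfolding right_reverses_def
  by (induction rule: converse_rtranclp_induct) (auto intro: tail_rel_step)

lemma reverses_sound:
  assumes "right_reverses S R (inv_word u @ pos_word v) (pos_word v' @ inv_word u')"
    and "v \<in> lists S" "v' \<in> lists S" "u' \<in> lists S"
  shows "u @ v' \<approx> v @ u'"
proof -
  \<comment> \<open>The path passes through the empty word: \<open>v'\<close> is stripped from
    itself, then \<open>u'\<close> is prepended to \<open>[]\<close>.\<close>
  have "tail_rel (pos_word v' @ inv_word u') v' u'"
    unfolding tail_rel_append tail_rel_pos_word[OF assms(3)] tail_rel_inv_word
    using assms(3,4) by (intro exI[of _ "[]"]) (simp add: cong_refl)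
  from tail_rel_reverses[OF assms(1) this] obtain z where "u @ v' \<approx> z" "z \<approx> v @ u'"
    unfolding tail_rel_append tail_rel_pos_word[OF assms(2)] tail_rel_inv_word by blast
  then show ?thesis by (rule cong_trans)
qed

section \<open>Complements of letters and factored pairs of words\<close>

definition complement :: "'a \<Rightarrow> 'a \<Rightarrow> 'a list \<Rightarrow> 'a list \<Rightarrow> bool" where
  "complement s s' g h \<longleftrightarrow> (if s = s' then g = [] \<and> h = [] else {s # g, s' # h} \<in> R)"

lemma complement_lists: "complement s s' g h \<Longrightarrow> g \<in> lists S \<and> h \<in> lists S"
  unfolding complement_def
  using relation_lists(1,2)[of "s # g" "s' # h"] by (auto split: if_splits)

text \<open>Condition (i) fixes the outcome of reversing two letters. For equal letters
  \<open>complement\<close> admits only deletion, which keeps the outcome unique even if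
  \<open>R\<close> contains a trivial relation \<open>s v = s v\<close>.\<close>

lemma complement_unique:
  assumes "complement s s' g h" "complement s s' g' h'" "s \<in> S" "s' \<in> S"
  shows "g' = g \<and> h' = h"
proof (cases "s = s'")
  case True
  with assms show ?thesis by (simp add: complement_def)
next
  case False
  then have "{s # g, s' # h} \<in> R" "{s # g', s' # h'} \<in> R"
    using assms by (auto simp: complement_def)
  then show ?thesis
    using at_most_one[OF assms(3,4)] complement_lists[OF assms(1)] complement_lists[OF assms(2)]
    unfolding at_most_one_relation_def by blast
qed

lemma complement_sym: "complement s s' g h \<Longrightarrow> complement s' s h g"
  unfolding complement_def by (auto simp: insert_commute split: if_splits)

text \<open>A relation between equal letters need not be a \<open>complement\<close>. Being
  unordered it can be read both ways, so (i) forces \<open>g = h\<close>, and \<open>g\<close> is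
  absorbed into the new tail \<open>t'\<close>.\<close>

lemma complement_relation:
  assumes "{s # g, s' # h} \<in> R" "t \<in> lists S"
  shows "\<exists>g' h' t'. complement s s' g' h' \<and> g @ t \<approx> g' @ t' \<and> h @ t \<approx> h' @ t'"
proof -
  have l: "s \<in> S" "s' \<in> S" "g \<in> lists S" "h \<in> lists S"
    using relation_lists(1,2)[OF assms(1)] by auto
  have r: "g @ t \<approx> g @ t" "h @ t \<approx> h @ t"
    using l assms by (auto intro!: cong_refl)
  show ?thesis
  proof (cases "s = s'")
    case True
    with assms(1) have "{s # g, s' # h} \<in> R" "{s # h, s' # g} \<in> R"
      by (simp_all add: insert_commute)
    then have "g = h"
      using at_most_one[OF l(1,2)] l(3,4) unfolding at_most_one_relation_def by blast
    then show ?thesis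
      using True r by (intro exI[of _ "[]"] exI[of _ "g @ t"]) (simp add: complement_def)
  next
    case False
    then show ?thesis
      using assms(1) r by (intro exI[of _ g] exI[of _ h] exI[of _ t]) (simp add: complement_def)
  qed
qed

lemma complement_reverses:
  assumes "complement s s' g h" "s \<in> S" "s' \<in> S"
  shows "right_reverses S R [Neg s, Pos s'] (pos_word g @ inv_word h)"
proof (cases "s = s'")
  case True
  with assms show ?thesis
    using right_rev_step.delete[of s S R "[]" "[]"]
    by (auto simp: complement_def right_reverses_def)
next
  case False
  with assms have "{s # g, s' # h} \<in> R" by (simp add: complement_def)
  moreover have "g \<in> lists S" "h \<in> lists S" using complement_lists[OF assms(1)] by auto
  ultimately show ?thesis
    using right_rev_step.replace[of s S s' h g R "[]" "[]"] assms
    by (auto simp: right_reverses_def)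
qed

definition factored :: "'a list \<Rightarrow> 'a list \<Rightarrow> bool" where
  "factored w w' \<longleftrightarrow> w = [] \<and> w' = [] \<or>
     (\<exists>s u s' u' g h t. w = s # u \<and> w' = s' # u' \<and>
        complement s s' g h \<and> u \<approx> g @ t \<and> u' \<approx> h @ t)"

lemma factored_Cons:
  "factored (s # u) (s' # u') \<longleftrightarrow>
     (\<exists>g h t. complement s s' g h \<and> u \<approx> g @ t \<and> u' \<approx> h @ t)"
  unfolding factored_def by auto

lemma factored_refl: "w \<in> lists S \<Longrightarrow> factored w w"
proof (cases w)
  case (Cons s u)
  moreover assume "w \<in> lists S"
  ultimately show ?thesis
    unfolding factored_def complement_def by (auto intro!: exI[of _ "[]"] exI[of _ u] cong_refl)
qed (simp add: factored_def)

lemma factored_sym: "factored w w' \<Longrightarrow> factored w' w"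
  unfolding factored_def using complement_sym by blast

text \<open>If \<open>u\<close> is nonempty, then so is \<open>u'\<close>, the first letters and
  their complement stay the same, and only the common tail grows from \<open>t\<close> to
  \<open>t @ v\<close>. If \<open>u\<close> is empty, so is \<open>u'\<close>, and the claim
  concerns \<open>v\<close> and \<open>v'\<close> alone.\<close>

lemma factored_append:
  assumes "factored u u'" "factored v v'" "v \<approx> v'"
  shows "factored (u @ v) (u' @ v')"
proof (cases "u = []")
  case True
  with assms show ?thesis by (simp add: factored_def)
next
  case False
  with assms(1) obtain s p s' p' g h t where *: "u = s # p" "u' = s' # p'"
    "complement s s' g h" "p \<approx> g @ t" "p' \<approx> h @ t"
    unfolding factored_def by blast
  have v: "v \<in> lists S" using cong_lists[OF assms(3)] by simp
  have "p @ v \<approx> g @ t @ v" "p' @ v' \<approx> h @ t @ v"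
    using cong_right[OF *(4) v] cong_append[OF *(5) cong_sym[OF assms(3)]] by simp_all
  then show ?thesis
    using * by (auto simp: factored_Cons)
qed

section \<open>Grids of reversings on a domain of factored words\<close>

definition factor_closed :: "'a list set \<Rightarrow> bool" where
  "factor_closed D \<longleftrightarrow> (\<forall>w\<in>D. \<forall>u v. w \<approx> u @ v \<longrightarrow> v \<in> D) \<and>
     (\<forall>w\<in>D. \<forall>w'. w \<approx> w' \<longrightarrow> factored w w')"

lemma factor_closedD:
  assumes "factor_closed D" "w \<in> D"
  shows "w \<approx> u @ v \<Longrightarrow> v \<in> D" "w \<approx> v \<Longrightarrow> v \<in> D" "w \<approx> w' \<Longrightarrow> factored w w'"
  using assms unfolding factor_closed_def by (blast, metis append_Nil, blast)

text \<open>\<open>b @ e\<close> is the far corner of a completed reversing diagram, and the second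
  clause makes every common right-multiple in \<open>D\<close> factor through it. The domain
  \<open>D\<close> is a parameter because grids are used twice: on short words inside the induction
  on length, and on \<open>UNIV\<close> once all equivalent words are factored.\<close>

definition grid :: "'a list set \<Rightarrow> 'a list \<Rightarrow> 'a list \<Rightarrow> 'a list \<Rightarrow> 'a list \<Rightarrow> bool" where
  "grid D b c e f \<longleftrightarrow>
     right_reverses S R (inv_word b @ pos_word c) (pos_word e @ inv_word f) \<and>
     (\<forall>w w'. b @ w \<approx> c @ w' \<longrightarrow> b @ w \<in> D \<longrightarrow> (\<exists>r. w \<approx> e @ r \<and> w' \<approx> f @ r))"

lemma gridD:
  assumes "grid D b c e f" "b @ w \<approx> c @ w'" "b @ w \<in> D"
  obtains r where "w \<approx> e @ r" "w' \<approx> f @ r"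
  using assms unfolding grid_def by blast

text \<open>A common multiple bounds the diagram. Reversing the first letters into \<open>g\<close>
  and \<open>h\<close> leaves three squares, \<open>b1\<close> against \<open>g\<close>,
  \<open>h\<close> against \<open>c1\<close>, and \<open>f1\<close> against \<open>e2\<close>; their
  common multiples \<open>b1 @ w\<close>, \<open>h @ t\<close> and \<open>t\<close> are shorter, so
  the induction on length fills them.\<close>

lemma grid_exists:
  assumes D: "factor_closed D" and "b @ w \<approx> c @ w'" "b @ w \<in> D"
  shows "\<exists>e f. grid D b c e f"
  using assms(2,3)
proof (induction "len (b @ w)" arbitrary: b c w w' rule: less_induct)
  case less
  note bw = less.prems
  show ?case
  proof (cases "b = [] \<or> c = []")
    case True
    then show ?thesis
    proof
      assume "b = []"
      have "\<exists>r. x \<approx> c @ r \<and> x' \<approx> [] @ r" if "x \<approx> c @ x'" for x x'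
        using that cong_refl[of x'] cong_lists[OF that] by auto
      with \<open>b = []\<close> have "grid D b c c []"
        by (simp add: grid_def right_reverses_def)
      then show ?thesis by blast
    next
      assume "c = []"
      have "\<exists>r. x \<approx> [] @ r \<and> x' \<approx> b @ r" if "b @ x \<approx> x'" for x x'
        using that cong_refl[of x] cong_lists[OF that] cong_sym[OF that] by auto
      with \<open>c = []\<close> have "grid D b c [] b"
        by (simp add: grid_def right_reverses_def)
      then show ?thesis by blast
    qed
  next
    case False
    then obtain s b1 s' c1 where bc: "b = s # b1" "c = s' # c1"
      by (meson neq_Nil_conv)
    have l: "s \<in> S" "b1 \<in> lists S" "s' \<in> S" "c1 \<in> lists S" "w \<in> lists S" "w' \<in> lists S"
      using cong_lists[OF bw(1)] bc by auto
    from factor_closedD(3)[OF D bw(2,1)] obtain g h t where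
      gh: "complement s s' g h" and t: "b1 @ w \<approx> g @ t" "c1 @ w' \<approx> h @ t"
      using bc by (auto simp: factored_Cons)
    note ghl = complement_lists[OF gh]
    have tl: "t \<in> lists S" using cong_lists[OF t(1)] by simp
    \<comment> \<open>Stated for arbitrary \<open>x\<close>, \<open>x'\<close>, \<open>k\<close>: it
      serves the given multiple, to build the squares, and later every other multiple, to factor
      through them.\<close>
    have inD: "b1 @ x \<in> D \<and> c1 @ x' \<in> D \<and> h @ k \<in> D \<and> k \<in> D"
      if "s # b1 @ x \<in> D" "s # b1 @ x \<approx> s' # c1 @ x'" "c1 @ x' \<approx> h @ k" for x x' k
    proof -
      have "s # b1 @ x \<approx> [s] @ b1 @ x"
        using cong_lists[OF that(2)] cong_refl by simp
      then have 1: "b1 @ x \<in> D" using factor_closedD(1)[OF D that(1)] by blast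
      have "c1 @ x' \<in> D" using factor_closedD(1)[OF D that(1), of "[s']"] that(2) by simp
      then show ?thesis
        using 1 that(3) factor_closedD(1,2)[OF D, of "c1 @ x'"] by blast
    qed
    have small: "len (b1 @ w) < len (b @ w)" "len (h @ t) < len (b @ w)" "len t < len (b @ w)"
    proof -
      show 1: "len (b1 @ w) < len (b @ w)"
        using len_Cons[of s "b1 @ w"] l bc by simp
      have "len (c1 @ w') < len (c @ w')"
        using len_Cons[of s' "c1 @ w'"] l bc by simp
      then show "len (h @ t) < len (b @ w)"
        using len_cong[OF t(2)] len_cong[OF bw(1)] by simp
      show "len t < len (b @ w)"
        using 1 len_cong[OF t(1)] len_suffix[of g t] ghl tl by simp
    qed
    have D0: "b1 @ w \<in> D" "h @ t \<in> D" "t \<in> D"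
      using inD[of w w' t] bw bc t(2) by auto
    obtain e1 f1 where g1: "grid D b1 g e1 f1"
      using less.hyps[OF small(1) t(1) D0(1)] by blast
    obtain e2 f2 where g2: "grid D h c1 e2 f2"
      using less.hyps[OF small(2) cong_sym[OF t(2)] D0(2)] by blast
    obtain x where x: "w \<approx> e1 @ x" "t \<approx> f1 @ x"
      using gridD[OF g1 t(1) D0(1)] by blast
    obtain y where y: "t \<approx> e2 @ y" "w' \<approx> f2 @ y"
      using gridD[OF g2 cong_sym[OF t(2)] D0(2)] by blast
    \<comment> \<open>\<open>t\<close> is a common right-multiple of \<open>f1\<close> and
      \<open>e2\<close>, which opens the third square.\<close>
    have xy: "f1 @ x \<approx> e2 @ y" by (rule cong_trans[OF cong_sym[OF x(2)] y(1)])
    have "len (f1 @ x) < len (b @ w)" using small(3) len_cong[OF x(2)] by simp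
    moreover have "f1 @ x \<in> D" by (rule factor_closedD(2)[OF D D0(3) x(2)])
    ultimately obtain e3 f3 where g3: "grid D f1 e2 e3 f3"
      using less.hyps[OF _ xy] by blast
    have el: "e1 \<in> lists S" "f2 \<in> lists S"
      using cong_lists[OF x(1)] cong_lists[OF y(2)] by auto
    have rev: "right_reverses S R (inv_word b @ pos_word c)
                 (pos_word (e1 @ e3) @ inv_word (f2 @ f3))"
    proof -
      have r0: "right_reverses S R (inv_word b @ pos_word c)
          (inv_word b1 @ (pos_word g @ inv_word h) @ pos_word c1)"
        using right_reverses_context[OF complement_reverses[OF gh l(1,3)],
            of "inv_word b1" "pos_word c1"] bc by simp
      have "right_reverses S R (inv_word b1 @ pos_word g) (pos_word e1 @ inv_word f1)"
        using g1 by (simp add: grid_def)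
      from right_reverses_context[OF this, of "[]" "inv_word h @ pos_word c1"]
      have r1: "right_reverses S R (inv_word b1 @ (pos_word g @ inv_word h) @ pos_word c1)
          ((pos_word e1 @ inv_word f1) @ inv_word h @ pos_word c1)" by simp
      have "right_reverses S R (inv_word h @ pos_word c1) (pos_word e2 @ inv_word f2)"
        using g2 by (simp add: grid_def)
      from right_reverses_context[OF this, of "pos_word e1 @ inv_word f1" "[]"]
      have r2: "right_reverses S R ((pos_word e1 @ inv_word f1) @ inv_word h @ pos_word c1)
          (pos_word e1 @ (inv_word f1 @ pos_word e2) @ inv_word f2)" by simp
      have "right_reverses S R (inv_word f1 @ pos_word e2) (pos_word e3 @ inv_word f3)"
        using g3 by (simp add: grid_def)
      from right_reverses_context[OF this, of "pos_word e1" "inv_word f2"]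
      have r3: "right_reverses S R (pos_word e1 @ (inv_word f1 @ pos_word e2) @ inv_word f2)
          (pos_word (e1 @ e3) @ inv_word (f2 @ f3))" by simp
      show ?thesis
        using r0 r1 r2 r3 by (blast intro: right_reverses_trans)
    qed
    have "\<exists>r. v \<approx> (e1 @ e3) @ r \<and> v' \<approx> (f2 @ f3) @ r"
      if v: "b @ v \<approx> c @ v'" "b @ v \<in> D" for v v'
    proof -
      from factor_closedD(3)[OF D v(2,1)] obtain g' h' k where
        gh': "complement s s' g' h'" and k': "b1 @ v \<approx> g' @ k" "c1 @ v' \<approx> h' @ k"
        using bc by (auto simp: factored_Cons)
      \<comment> \<open>The new multiple is factored by the same \<open>g\<close> and
        \<open>h\<close>, so it can be chased through the three squares already built.\<close>
      from complement_unique[OF gh gh' l(1,3)]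
      have k: "b1 @ v \<approx> g @ k" "c1 @ v' \<approx> h @ k" using k' by auto
      have D1: "b1 @ v \<in> D" "h @ k \<in> D" "k \<in> D"
        using inD[of v v' k] v bc k(2) by auto
      obtain x where x: "v \<approx> e1 @ x" "k \<approx> f1 @ x"
        using gridD[OF g1 k(1) D1(1)] by blast
      obtain y where y: "k \<approx> e2 @ y" "v' \<approx> f2 @ y"
        using gridD[OF g2 cong_sym[OF k(2)] D1(2)] by blast
      obtain r where r: "x \<approx> e3 @ r" "y \<approx> f3 @ r"
        using gridD[OF g3 cong_trans[OF cong_sym[OF x(2)] y(1)]
            factor_closedD(2)[OF D D1(3) x(2)]] by blast
      have "v \<approx> e1 @ e3 @ r" "v' \<approx> f2 @ f3 @ r"
        using cong_trans[OF x(1) cong_left[OF r(1) el(1)]]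
          cong_trans[OF y(2) cong_left[OF r(2) el(2)]] by simp_all
      then show ?thesis by auto
    qed
    with rev show ?thesis unfolding grid_def by blast
  qed
qed

end

section \<open>The cube condition and the factoring of equivalent words\<close>

locale cube_presentation = graded_presentation +
  assumes cube: "s \<in> S \<Longrightarrow> s' \<in> S \<Longrightarrow> s'' \<in> S \<Longrightarrow> right_cube_condition S R [s] [s'] [s'']"
begin

text \<open>
  The only factor \<open>Neg _, Pos _\<close> of the reversed word is \<open>s\<^sup>-\<^sup>1 s'\<close>, so the reversing has to
  start there.
\<close>

lemma reverses_to_Nil_factored:
  assumes rev: "right_reverses S R (inv_word (s # p) @ pos_word (s' # q)) []"
    and l: "s \<in> S" "s' \<in> S" "p \<in> lists S" "q \<in> lists S"
  shows "\<exists>g h t. complement s s' g h \<and> p \<approx> g @ t \<and> q \<approx> h @ t"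
proof -
  from rev obtain w where step: "right_rev_step S R (inv_word (s # p) @ pos_word (s' # q)) w"
    and w: "right_reverses S R w []"
    unfolding right_reverses_def by (cases rule: converse_rtranclpE) auto
  \<comment> \<open>The rest of the reversing is used only through the action: \<open>w\<close>
    relates \<open>[]\<close> to \<open>[]\<close>, which unfolds into equivalences between
    \<open>p\<close>, \<open>q\<close> and the words of the first step.\<close>
  have "tail_rel [] [] []" by (simp add: cong_refl)
  then have tail: "tail_rel w [] []" by (rule tail_rel_reverses[OF w])
  from step show ?thesis
  proof cases
    case (replace a a' h g x y)
    have "x @ Neg a # Pos a' # y = inv_word (s # p) @ pos_word (s' # q)"
      using replace(1) by (simp only: append_Cons append_Nil)
    then have eq: "a = s" "a' = s'" "x = inv_word p" "y = pos_word q"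
      by (blast dest: neg_pos_word_split)+
    from tail obtain z1 z2 z3 where
      "p \<approx> z1" "z1 \<approx> g @ z2" "h @ z2 \<approx> z3" "z3 \<approx> q"
      unfolding replace(2) eq tail_rel_append tail_rel_inv_word
        tail_rel_pos_word[OF replace(6)] tail_rel_pos_word[OF l(4)]
      by auto
    then have t: "p \<approx> g @ z2" "q \<approx> h @ z2"
      by (blast intro: cong_trans cong_sym)+
    have "z2 \<in> lists S" using cong_lists[OF t(1)] by simp
    \<comment> \<open>The first step may have applied a relation even though \<open>s = s'\<close>;
      this turns it into a genuine \<open>complement\<close>.\<close>
    with complement_relation[of s g s' h z2] replace(7) eq
    obtain g' h' t' where "complement s s' g' h'" "g @ z2 \<approx> g' @ t'" "h @ z2 \<approx> h' @ t'"
      by auto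
    with t show ?thesis by (blast intro: cong_trans)
  next
    case (delete a x y)
    have "x @ Neg a # Pos a # y = inv_word (s # p) @ pos_word (s' # q)"
      using delete(1) by (simp only: append_Cons append_Nil)
    then have eq: "a = s" "a = s'" "x = inv_word p" "y = pos_word q"
      by (blast dest: neg_pos_word_split)+
    from tail have "p \<approx> q"
      using l(4) unfolding delete(2) eq tail_rel_append
      by (auto simp: tail_rel_pos_word tail_rel_inv_word simp del: in_lists_conv_set
          intro: cong_trans)
    then show ?thesis
      using eq l(4) by (intro exI[of _ "[]"] exI[of _ q]) (auto simp: complement_def intro: cong_refl)
  qed
qed

text \<open>The middle word sets the bound: \<open>u''\<close> is shorter than
  \<open>w' = s'' # u''\<close>, so the grid for its factorizations \<open>b @ p\<close> and
  \<open>c @ q\<close> needs factoring only for words covered by \<open>IH\<close>.\<close>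

lemma factored_trans:
  assumes IH: "\<And>v v'. v \<approx> v' \<Longrightarrow> len v < len w' \<Longrightarrow> factored v v'"
    and w: "factored w w'" "factored w' w''" and l: "w \<in> lists S" "w' \<in> lists S" "w'' \<in> lists S"
  shows "factored w w''"
proof (cases "w' = []")
  case True
  with w show ?thesis by (simp add: factored_def)
next
  case False
  with w(1) obtain s u s'' u'' a b p where 1: "w = s # u" "w' = s'' # u''"
    "complement s s'' a b" "u \<approx> a @ p" "u'' \<approx> b @ p"
    unfolding factored_def by blast
  with w(2) obtain s' u' c d q where 2: "w'' = s' # u'"
    "complement s'' s' c d" "u'' \<approx> c @ q" "u' \<approx> d @ q"
    unfolding factored_def by blast
  have S: "s \<in> S" "s' \<in> S" "s'' \<in> S" "u'' \<in> lists S" using l 1 2 by auto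
  define D where "D = {v. len v < len w'}"
  have D: "factor_closed D"
    unfolding factor_closed_def
  proof (intro conjI ballI allI impI)
    fix v x y assume v: "v \<in> D" "v \<approx> x @ y"
    have "len y \<le> len (x @ y)" using cong_lists[OF v(2)] by (intro len_suffix) auto
    with v show "y \<in> D" using len_cong[OF v(2)] by (simp add: D_def)
  next
    fix v v' assume "v \<in> D" "v \<approx> v'"
    then show "factored v v'" using IH by (simp add: D_def)
  qed
  have pq: "b @ p \<approx> c @ q" by (rule cong_trans[OF cong_sym[OF 1(5)] 2(3)])
  have bD: "b @ p \<in> D"
    using len_cong[OF 1(5)] len_Cons[OF S(3,4)] 1(2) by (simp add: D_def)
  obtain e f where ef: "grid D b c e f" using grid_exists[OF D pq bD] by blast
  obtain r where r: "p \<approx> e @ r" "q \<approx> f @ r" using gridD[OF ef pq bD] by blast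
  have ls: "a \<in> lists S" "d \<in> lists S" "e \<in> lists S" "f \<in> lists S" "r \<in> lists S"
    using complement_lists[OF 1(3)] complement_lists[OF 2(2)]
      cong_lists[OF r(1)] cong_lists[OF r(2)] by auto
  \<comment> \<open>The two letter pairs reverse to \<open>a\<close>, \<open>b\<close> inverted,
    \<open>c\<close>, \<open>d\<close> inverted; the grid then replaces the two inner words by
    \<open>e\<close> and \<open>f\<close> inverted.\<close>
  have "right_reverses S R (inv_word [s] @ pos_word [s''] @ inv_word [s''] @ pos_word [s'])
      (pos_word (a @ e) @ inv_word (d @ f))"
  proof -
    have r1: "right_reverses S R (inv_word [s] @ pos_word [s''] @ inv_word [s''] @ pos_word [s'])
        ((pos_word a @ inv_word b) @ [Neg s'', Pos s'])"
      using right_reverses_context[OF complement_reverses[OF 1(3) S(1,3)],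
          of "[]" "[Neg s'', Pos s']"] by simp
    have r2: "right_reverses S R ((pos_word a @ inv_word b) @ [Neg s'', Pos s'])
        (pos_word a @ (inv_word b @ pos_word c) @ inv_word d)"
      using right_reverses_context[OF complement_reverses[OF 2(2) S(3,2)],
          of "pos_word a @ inv_word b" "[]"] by simp
    have "right_reverses S R (inv_word b @ pos_word c) (pos_word e @ inv_word f)"
      using ef by (simp add: grid_def)
    from right_reverses_context[OF this, of "pos_word a" "inv_word d"]
    have r3: "right_reverses S R (pos_word a @ (inv_word b @ pos_word c) @ inv_word d)
        (pos_word (a @ e) @ inv_word (d @ f))" by simp
    show ?thesis using r1 r2 r3 by (blast intro: right_reverses_trans)
  qed
  moreover have ael: "a @ e \<in> lists S" "d @ f \<in> lists S" using ls by auto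
  ultimately have "right_reverses S R (inv_word ([s] @ a @ e) @ pos_word ([s'] @ d @ f)) []"
    using cube[OF S(1,2,3)] unfolding right_cube_condition_def by blast
  then obtain g h t where t: "complement s s' g h" "a @ e \<approx> g @ t" "d @ f \<approx> h @ t"
    using reverses_to_Nil_factored[OF _ S(1,2) ael] by auto
  \<comment> \<open>The cube condition has factored \<open>s # a @ e\<close> and
    \<open>s' # d @ f\<close>; the given words extend these by the same \<open>r\<close>.\<close>
  have "u \<approx> (a @ e) @ r" "u' \<approx> (d @ f) @ r"
    using cong_trans[OF 1(4) cong_left[OF r(1) ls(1)]]
      cong_trans[OF 2(4) cong_left[OF r(2) ls(2)]] by simp_all
  moreover have "(a @ e) @ r \<approx> g @ t @ r" "(d @ f) @ r \<approx> h @ t @ r"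
    using cong_right[OF t(2) ls(5)] cong_right[OF t(3) ls(5)] by simp_all
  ultimately show ?thesis
    unfolding 1(1) 2(1) factored_Cons using t(1) by (blast intro: cong_trans)
qed

text \<open>Two nested inductions: on the length, which feeds \<open>factored_trans\<close>, and on
  the derivation of the equivalence at a fixed bound \<open>n\<close>.\<close>

lemma cong_factored: "w \<approx> w' \<Longrightarrow> factored w w'"
proof (induction "len w" arbitrary: w w' rule: less_induct)
  case less
  define n where "n = len w"
  have IH: "factored v v'" if "v \<approx> v'" "len v < n" for v v'
    using less.hyps that by (simp add: n_def)
  \<comment> \<open>An inequality, since the parts of a concatenation may be shorter than the whole;
    superadditivity keeps both within \<open>n\<close>.\<close>
  have "len w \<le> n \<Longrightarrow> factored w w'"
    using less.prems
  proof (induction rule: pres_cong.induct)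
    case (relation v v')
    note l = relation_lists[OF relation(1)]
    obtain s g s' h where eq: "v = s # g" "v' = s' # h"
      using l(3,4) by (meson neq_Nil_conv)
    then show ?case
      using complement_relation[of s g s' h "[]"] relation(1) by (simp add: factored_Cons)
  next
    case (refl v)
    then show ?case by (simp add: factored_refl del: in_lists_conv_set)
  next
    case (sym u v)
    then show ?case using len_cong[OF sym(1)] by (simp add: factored_sym)
  next
    case (trans u v w)
    have "len v \<le> n" using trans.prems len_cong[OF trans(1)] by simp
    then show ?case
      using trans IH cong_lists[OF trans(1)] cong_lists[OF trans(2)]
      by (intro factored_trans[of v u w]) auto
  next
    case (append u u' v v')
    have "len u + len v \<le> n"
      using len_append[of u v] append cong_lists[OF append(1)] cong_lists[OF append(2)] by simp
    with append show ?case by (intro factored_append) auto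
  qed
  then show ?case by (simp add: n_def)
qed

text \<open>On \<open>UNIV\<close> the domain condition of a grid is vacuous. Its corner is a common
  right-multiple by soundness of reversing, and least by the factoring clause of
  \<open>grid\<close>.\<close>

lemma word_lcm:
  assumes "u @ p \<approx> v @ q"
  shows "\<exists>e f. u @ e \<approx> v @ f \<and> (\<forall>w w'. u @ w \<approx> v @ w' \<longrightarrow> (\<exists>r. w \<approx> e @ r))"
proof -
  have D: "factor_closed UNIV"
    unfolding factor_closed_def by (auto intro: cong_factored)
  obtain e f where ef: "grid UNIV u v e f"
    using grid_exists[OF D assms] by blast
  obtain r where "p \<approx> e @ r" "q \<approx> f @ r"
    using gridD[OF ef assms] by blast
  then have "e \<in> lists S" "f \<in> lists S" "v \<in> lists S"
    using cong_lists assms by (metis append_in_lists_conv)+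
  then have "u @ e \<approx> v @ f"
    using ef by (intro reverses_sound) (auto simp: grid_def)
  moreover have "\<exists>r. w \<approx> e @ r" if "u @ w \<approx> v @ w'" for w w'
    using gridD[OF ef that] by blast
  ultimately show ?thesis by blast
qed

end

section \<open>Transfer from words to the monoid\<close>

theorem theorem2:
  fixes M :: "('m, 'b) monoid_scheme"
    and S :: "'a set"
    and R :: "'a list set set"
    and \<phi> :: "'a list set \<Rightarrow> 'm"
  assumes "admits_presentation M S R \<phi>"
    and "\<forall>s\<in>S. \<forall>s'\<in>S. at_most_one_relation S R s s'"
    and "\<exists>len :: 'm \<Rightarrow> nat.
           (\<forall>x\<in>carrier M. \<forall>y\<in>carrier M. len (x \<otimes>\<^bsub>M\<^esub> y) \<ge> len x + len y) \<and>
           (\<forall>s\<in>S. len (\<phi> (pres_class S R [s])) \<ge> 1)"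
    and "\<forall>s\<in>S. \<forall>s'\<in>S. \<forall>s''\<in>S. right_cube_condition S R [s] [s'] [s'']"
  shows "\<forall>x\<in>carrier M. \<forall>y\<in>carrier M.
           (\<exists>z\<in>carrier M. x divides\<^bsub>M\<^esub> z \<and> y divides\<^bsub>M\<^esub> z) \<longrightarrow>
           (\<exists>z\<in>carrier M. z lcmof\<^bsub>M\<^esub> x y)"
proof -
  have pres: "presentation S R" and iso: "\<phi> \<in> iso (presented_monoid S R) M"
    using assms(1) by (auto simp: admits_presentation_def)
  define elt where "elt w = \<phi> (pres_class S R w)" for w
  have cls: "pres_class S R w \<in> carrier (presented_monoid S R)" if "w \<in> lists S" for w
    using that by (simp add: presented_monoid_def pres_class_def quotientI del: in_lists_conv_set)
  have closed: "elt w \<in> carrier M" if "w \<in> lists S" for w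
    using iso cls[OF that] by (auto simp: elt_def iso_def hom_def)
  have mult: "elt (u @ v) = elt u \<otimes>\<^bsub>M\<^esub> elt v" if "u \<in> lists S" "v \<in> lists S" for u v
    using iso cls[OF that(1)] cls[OF that(2)] pres_class_mult[OF pres that]
    by (simp add: elt_def iso_def hom_def) metis
  have elt_eq: "elt u = elt v \<longleftrightarrow> (u, v) \<in> pres_cong S R"
    if "u \<in> lists S" "v \<in> lists S" for u v
  proof -
    have "inj_on \<phi> (carrier (presented_monoid S R))"
      using iso by (auto simp: iso_def bij_betw_def)
    then have "elt u = elt v \<longleftrightarrow> pres_class S R u = pres_class S R v"
      unfolding elt_def using cls that by (simp add: inj_on_eq_iff)
    then show ?thesis
      unfolding pres_class_def using eq_equiv_class_iff[OF equiv_pres_cong[OF pres] that] by simp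
  qed
  have surj: "\<exists>w\<in>lists S. x = elt w" if "x \<in> carrier M" for x
  proof -
    from iso that obtain X where "X \<in> carrier (presented_monoid S R)" "x = \<phi> X"
      by (auto simp: iso_def bij_betw_def)
    then show ?thesis
      by (auto simp: elt_def presented_monoid_def pres_class_def quotient_def
          simp del: in_lists_conv_set)
  qed
  obtain len :: "'m \<Rightarrow> nat" where len:
    "\<And>x y. x \<in> carrier M \<Longrightarrow> y \<in> carrier M \<Longrightarrow> len x + len y \<le> len (x \<otimes>\<^bsub>M\<^esub> y)"
    "\<And>s. s \<in> S \<Longrightarrow> 1 \<le> len (elt [s])"
    using assms(3) unfolding elt_def by blast
  \<comment> \<open>The grading of \<open>M\<close> is pulled back to words along
    \<open>elt\<close>, so it is constant on equivalence classes.\<close>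
  interpret cube_presentation S R "\<lambda>w. len (elt w)"
  proof
    show "presentation S R" by (rule pres)
    show "len (elt u) + len (elt v) \<le> len (elt (u @ v))" if "u \<in> lists S" "v \<in> lists S" for u v
      using len(1) mult closed that by (simp del: in_lists_conv_set)
    show "len (elt u) = len (elt v)" if "(u, v) \<in> pres_cong S R" for u v
      using that elt_eq pres_cong_in_lists[OF pres that] by metis
  qed (use assms len in auto)
  \<comment> \<open>Surjectivity of \<open>elt\<close> supplies a word for the cofactor, and
    injectivity on classes turns the equation in \<open>M\<close> into an equivalence of
    words.\<close>
  have divides: "elt u divides\<^bsub>M\<^esub> elt w \<longleftrightarrow> (\<exists>p. w \<approx> u @ p)"
    if "u \<in> lists S" "w \<in> lists S" for u w
  proof
    assume "elt u divides\<^bsub>M\<^esub> elt w"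
    then obtain y where y: "y \<in> carrier M" "elt w = elt u \<otimes>\<^bsub>M\<^esub> y" by (auto simp: factor_def)
    then obtain p where p: "p \<in> lists S" "y = elt p" using surj by blast
    then have "elt w = elt (u @ p)" using y(2) mult[OF that(1) p(1)] by simp
    then have "w \<approx> u @ p" using elt_eq[of w "u @ p"] that p(1) by simp
    then show "\<exists>p. w \<approx> u @ p" by blast
  next
    assume "\<exists>p. w \<approx> u @ p"
    then obtain p where p: "w \<approx> u @ p" by blast
    then have "p \<in> lists S" using cong_lists[OF p] by simp
    moreover have "elt w = elt (u @ p)"
      using elt_eq[of w "u @ p"] p cong_lists[OF p] by blast
    ultimately show "elt u divides\<^bsub>M\<^esub> elt w"
      using mult[OF that(1)] closed by (auto simp: factor_def simp del: in_lists_conv_set)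
  qed
  show ?thesis
  proof (intro ballI impI)
    fix x y
    assume x: "x \<in> carrier M" and y: "y \<in> carrier M"
      and z: "\<exists>z\<in>carrier M. x divides\<^bsub>M\<^esub> z \<and> y divides\<^bsub>M\<^esub> z"
    obtain u where u: "u \<in> lists S" "x = elt u" using surj[OF x] by blast
    obtain v where v: "v \<in> lists S" "y = elt v" using surj[OF y] by blast
    from z obtain w where w: "w \<in> lists S" "elt u divides\<^bsub>M\<^esub> elt w" "elt v divides\<^bsub>M\<^esub> elt w"
      unfolding u(2) v(2) using surj by blast
    then obtain p q where "w \<approx> u @ p" "w \<approx> v @ q"
      using divides[OF u(1) w(1)] divides[OF v(1) w(1)] by blast
    then have "u @ p \<approx> v @ q" by (blast intro: cong_trans cong_sym)
    from word_lcm[OF this] obtain e f where ef: "u @ e \<approx> v @ f"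
      and least: "\<And>w w'. u @ w \<approx> v @ w' \<Longrightarrow> \<exists>r. w \<approx> e @ r" by blast
    have ue: "u @ e \<in> lists S" using cong_lists[OF ef] by simp
    have "elt (u @ e) divides\<^bsub>M\<^esub> k"
      if "k \<in> carrier M" "x divides\<^bsub>M\<^esub> k" "y divides\<^bsub>M\<^esub> k" for k
    proof -
      obtain w where w: "w \<in> lists S" "k = elt w" using surj \<open>k \<in> carrier M\<close> by blast
      have "elt u divides\<^bsub>M\<^esub> elt w" "elt v divides\<^bsub>M\<^esub> elt w"
        using that(2,3) unfolding u(2) v(2) w(2) .
      then obtain p q where pq: "w \<approx> u @ p" "w \<approx> v @ q"
        using divides[OF u(1) w(1)] divides[OF v(1) w(1)] by blast
      then have "u @ p \<approx> v @ q" by (blast intro: cong_trans cong_sym)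
      then obtain r where "p \<approx> e @ r" using least by blast
      then have "w \<approx> (u @ e) @ r"
        using cong_trans[OF pq(1) cong_left[OF _ u(1)]] by simp
      then show ?thesis using divides[OF ue w(1)] w(2) by blast
    qed
    moreover have "x divides\<^bsub>M\<^esub> elt (u @ e)" "y divides\<^bsub>M\<^esub> elt (u @ e)"
      using divides[OF u(1) ue] divides[OF v(1) ue] ef cong_refl[OF ue] u v by auto
    ultimately have "elt (u @ e) lcmof\<^bsub>M\<^esub> x y"
      by (simp add: islcm_def)
    with closed[OF ue] show "\<exists>z\<in>carrier M. z lcmof\<^bsub>M\<^esub> x y" by blast
  qed
qed

end
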